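(* Let $L=L_0\oplus L_1$ be a superspace over $\mathbb{K}$, $[\cdot,\cdot]:L\times L\to L$ an even bilinear map and $\alpha:L\to L$ an even linear map. Then $(L,[\cdot,\cdot],\alpha)$ is a symmetric Hom-Leibniz superalgebra if and only if for all homogeneous $x,y,z\in L_0\cup L_1$, $$[\alpha(x),[y,z]]=[[x,y],\alpha(z)]+(-1)^{|x||y|}[\alpha(y),[x,z]],$$ $$[\alpha(y),[x,z]]=-(-1)^{(|x|+|z|)|y|}[[x,z],\alpha(y)].$$
   Context: All linear spaces are over a field $\mathbb{K}$ of characteristic different from $2$. A superspace is a $\mathbb{Z}_2$-graded linear space $L=L_0\oplus L_1$; $|x|\in\mathbb{Z}_2$ denotes the parity of a homogeneous element $x\in L_0\cup L_1$. A bilinear map $[\cdot,\cdot]$ is even if $[L_i,L_j]\subseteq L_{i+j}$; a linear map $\alpha$ is even if $\alpha(L_i)\subseteq L_i$. Let $L$ be a superspace with an even bilinear map $[\cdot,\cdot]$ and an even linear map $\alpha$. The triple $(L,[\cdot,\cdot],\alpha)$ is called: - a left Hom-Leibniz superalgebra if for all $x,y,z\in L_0\cup L_1$: $[\alpha(x),[y,z]]=[[x,y],\alpha(z)]+(-1)^{|x||y|}[\alpha(y),[x,z]]$; - a right Hom-Leibniz superalgebra if for all $x,y,z\in L_0\cup L_1$: $[\alpha(x),[y,z]]=[[x,y],\alpha(z)]-(-1)^{|y||z|}[[x,z],\alpha(y)]$; - a symmetric Hom-Leibniz superalgebra if it is both a left and a right Hom-Leibniz superalgebra. *)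

theory Defs
  imports "HOL-Computational_Algebra.Computational_Algebra" "HOL-Library.Z2"
begin

text \<open>
  The type \<^typ>\<open>bit\<close> of \<^theory>\<open>HOL-Library.Z2\<close> is the field with two elements; it serves as the
  group of parities. The underlying linear space of a superspace is the whole type \<open>'v\<close>.
\<close>

locale superspace = vector_space scale
  for scale :: "'k::field \<Rightarrow> 'v::ab_group_add \<Rightarrow> 'v" (infixr \<open>*s\<close> 75) +
  fixes L :: "bit \<Rightarrow> 'v set"
  assumes subspace_homogeneous: "subspace (L i)"
    and direct_sum: "\<exists>!p. fst p \<in> L 0 \<and> snd p \<in> L 1 \<and> v = fst p + snd p"

text \<open>The sign \<open>(-1) ^ i\<close> in the field, for an exponent \<open>i\<close> in \<open>\<int>\<^sub>2\<close>.\<close>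

definition parity_sign :: "bit \<Rightarrow> 'k::field" where
  "parity_sign i = (if i = 0 then 1 else - 1)"

locale hom_superalgebra = superspace scale L
  for scale :: "'k::field \<Rightarrow> 'v::ab_group_add \<Rightarrow> 'v" (infixr \<open>*s\<close> 75)
    and L :: "bit \<Rightarrow> 'v set" +
  fixes br :: "'v \<Rightarrow> 'v \<Rightarrow> 'v"
    and \<alpha> :: "'v \<Rightarrow> 'v"
  assumes linear_br_right: "Vector_Spaces.linear scale scale (\<lambda>y. br x y)"
    and linear_br_left: "Vector_Spaces.linear scale scale (\<lambda>x. br x y)"
    and br_even: "x \<in> L i \<Longrightarrow> y \<in> L j \<Longrightarrow> br x y \<in> L (i + j)"
    and linear_\<alpha>: "Vector_Spaces.linear scale scale \<alpha>"
    and \<alpha>_even: "x \<in> L i \<Longrightarrow> \<alpha> x \<in> L i"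

text \<open>
  Identities for homogeneous elements quantify over the parities explicitly. Only the vector 0
  has more than one parity, and there the identities hold trivially.
\<close>

locale left_hom_leibniz_superalgebra = hom_superalgebra scale L br \<alpha>
  for scale :: "'k::field \<Rightarrow> 'v::ab_group_add \<Rightarrow> 'v" (infixr \<open>*s\<close> 75)
    and L :: "bit \<Rightarrow> 'v set"
    and br :: "'v \<Rightarrow> 'v \<Rightarrow> 'v"
    and \<alpha> :: "'v \<Rightarrow> 'v" +
  assumes left_leibniz: "x \<in> L i \<Longrightarrow> y \<in> L j \<Longrightarrow> z \<in> L k \<Longrightarrow>
    br (\<alpha> x) (br y z) = br (br x y) (\<alpha> z) + parity_sign (i * j) *s br (\<alpha> y) (br x z)"

locale right_hom_leibniz_superalgebra = hom_superalgebra scale L br \<alpha>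
  for scale :: "'k::field \<Rightarrow> 'v::ab_group_add \<Rightarrow> 'v" (infixr \<open>*s\<close> 75)
    and L :: "bit \<Rightarrow> 'v set"
    and br :: "'v \<Rightarrow> 'v \<Rightarrow> 'v"
    and \<alpha> :: "'v \<Rightarrow> 'v" +
  assumes right_leibniz: "x \<in> L i \<Longrightarrow> y \<in> L j \<Longrightarrow> z \<in> L k \<Longrightarrow>
    br (\<alpha> x) (br y z) = br (br x y) (\<alpha> z) - parity_sign (j * k) *s br (br x z) (\<alpha> y)"

locale symmetric_hom_leibniz_superalgebra =
  left_hom_leibniz_superalgebra scale L br \<alpha> + right_hom_leibniz_superalgebra scale L br \<alpha>
  for scale :: "'k::field \<Rightarrow> 'v::ab_group_add \<Rightarrow> 'v" (infixr \<open>*s\<close> 75)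
    and L :: "bit \<Rightarrow> 'v set"
    and br :: "'v \<Rightarrow> 'v \<Rightarrow> 'v"
    and \<alpha> :: "'v \<Rightarrow> 'v"

end

theory Submission
  imports Defs
begin

text \<open>
  The left and right identities for \<open>x, y, z\<close> differ only in the last term, so given the left one,
  the right one amounts to
  \<open>(-1) ^ (\<bar>x\<bar> \<bar>y\<bar>) [\<alpha> y, [x, z]] = - (-1) ^ (\<bar>y\<bar> \<bar>z\<bar>) [[x, z], \<alpha> y]\<close>;
  multiplying by the first sign gives the second displayed identity.
\<close>

theorem proposition2p10:
  fixes scale :: "'k::field \<Rightarrow> 'v::ab_group_add \<Rightarrow> 'v"
    and L :: "bit \<Rightarrow> 'v set"
    and br :: "'v \<Rightarrow> 'v \<Rightarrow> 'v"
    and \<alpha> :: "'v \<Rightarrow> 'v"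
  assumes "CHAR('k) \<noteq> 2"
    and "hom_superalgebra scale L br \<alpha>"
  shows "symmetric_hom_leibniz_superalgebra scale L br \<alpha> \<longleftrightarrow>
    (\<forall>i j k. \<forall>x \<in> L i. \<forall>y \<in> L j. \<forall>z \<in> L k.
      br (\<alpha> x) (br y z) =
        br (br x y) (\<alpha> z) + scale (parity_sign (i * j)) (br (\<alpha> y) (br x z)) \<and>
      br (\<alpha> y) (br x z) = - scale (parity_sign ((i + k) * j)) (br (br x z) (\<alpha> y)))"
proof -
  interpret hom_superalgebra scale L br \<alpha> by fact
  \<comment> \<open>Multiply by the sign of \<open>i * j\<close>, which squares to 1: signs are
    multiplicative and \<open>i * j + j * k = (i + k) * j\<close>. With parities in
    \<open>bit\<close> this is a check of eight cases.\<close>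
  have sign_transfer: "scale (parity_sign (i * j)) u = - (scale (parity_sign (j * k)) v) \<longleftrightarrow>
      u = - (scale (parity_sign ((i + k) * j)) v)" for i j k u v
    by (cases i; cases j; cases k) (auto simp: parity_sign_def)
  \<comment> \<open>Cancelling \<open>b\<close> leaves the left side of
    \<open>sign_transfer\<close>. The vectors are arbitrary, so one equivalence serves both
    directions.\<close>
  have right_iff: "a = b - scale (parity_sign (j * k)) v \<longleftrightarrow>
      u = - (scale (parity_sign ((i + k) * j)) v)"
    if "a = b + scale (parity_sign (i * j)) u" for a b u v i j k
    using that sign_transfer [of i j u k v] by simp
  show ?thesis (is "_ \<longleftrightarrow> ?R")
  proof
    assume "symmetric_hom_leibniz_superalgebra scale L br \<alpha>"
    then interpret symmetric_hom_leibniz_superalgebra scale L br \<alpha> .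
    show ?R
    proof (intro allI ballI conjI)
      fix x y z i j k
      assume xyz: "x \<in> L i" "y \<in> L j" "z \<in> L k"
      show left: "br (\<alpha> x) (br y z) =
          br (br x y) (\<alpha> z) + scale (parity_sign (i * j)) (br (\<alpha> y) (br x z))"
        using left_leibniz [OF xyz] .
      \<comment> \<open>Here \<open>u\<close> and \<open>v\<close> are the two products of
        \<open>\<alpha> y\<close> and \<open>br x z\<close>, one in each order.\<close>
      show "br (\<alpha> y) (br x z) = - scale (parity_sign ((i + k) * j)) (br (br x z) (\<alpha> y))"
        by (rule iffD1 [OF right_iff [OF left] right_leibniz [OF xyz]])
    qed
  next
    assume R: ?R
    \<comment> \<open>The interpretation of \<open>hom_superalgebra\<close> settles the structural
      axioms, so only the two Leibniz identities remain.\<close>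
    show "symmetric_hom_leibniz_superalgebra scale L br \<alpha>"
    proof
      fix x y z i j k
      assume xyz: "x \<in> L i" "y \<in> L j" "z \<in> L k"
      show left: "br (\<alpha> x) (br y z) =
          br (br x y) (\<alpha> z) + scale (parity_sign (i * j)) (br (\<alpha> y) (br x z))"
        using R xyz by blast
      show "br (\<alpha> x) (br y z) =
          br (br x y) (\<alpha> z) - scale (parity_sign (j * k)) (br (br x z) (\<alpha> y))"
        unfolding right_iff [OF left] using R xyz by blast
    qed
  qed
qed

end
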